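(* Let $B$ be a quaternion algebra over $\mathbb{Q}$ which is ramified at $\infty$, and let $\sigma$ be an orthogonal involution of the first kind on $B$. Let $K=C^+(B,\sigma)$ be the associated even Clifford algebra. Then $K/\mathbb{Q}$ is an imaginary quadratic extension of $\mathbb{Q}$.
   Context: An involution of the first kind on a quaternion algebra $B/\mathbb{Q}$ is an additive anti-multiplicative map of square the identity which is the identity on the center $\mathbb{Q}$. It is orthogonal if over a splitting field of $B$ it becomes the adjoint involution of a non-degenerate symmetric bilinear form; equivalently, $\sigma(x)=u\gamma(x)u^{-1}$, where $\gamma$ is the canonical (symplectic) conjugation and $u\in B^*$ satisfies $\gamma(u)=-u$. The discriminant is $\mathrm{disc}(\sigma)=-\mathrm{Nrd}(u)\in\mathbb{Q}^*/\mathbb{Q}^{*2}$, and the even Clifford algebra of $(B,\sigma)$ is $C^+(B,\sigma)=\mathbb{Q}[X]/(X^2-\delta_\sigma)$, where $\delta_\sigma\in\mathbb{Q}^*$ is a representative of $\mathrm{disc}(\sigma)$. *)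

theory Defs
  imports
    "HOL-Analysis.Cartesian_Space"
    "HOL-Algebra.Embedded_Algebras"
    "HOL-Algebra.QuotRing"
    "HOL-Algebra.Algebraic_Closure_Type"
begin

section \<open>Algebras and extension of scalars\<close>

locale unital_algebra = vector_space scale
  for scale :: "'k::field \<Rightarrow> 'a::ring_1 \<Rightarrow> 'a" +
  assumes scale_mult_left: "scale r x * y = scale r (x * y)"
    and scale_mult_right: "x * scale r y = scale r (x * y)"

definition is_basis :: "('k::field \<Rightarrow> 'a::ab_group_add \<Rightarrow> 'a) \<Rightarrow> 'a set \<Rightarrow> bool" where
  "is_basis s E \<longleftrightarrow> \<not> module.dependent s E \<and> module.span s E = UNIV"

text \<open>
  The map \<open>\<phi>\<close> identifies the \<open>L\<close>-algebra \<open>A\<close> (scalar multiplication \<open>t\<close>, product \<open>mul\<close>,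
  unit \<open>e\<close>) with \<open>B \<otimes>\<^sub>\<rat> L\<close>: it is a homomorphism of \<open>\<rat>\<close>-algebras whose \<open>L\<close>-linear extension
  \<open>B \<otimes>\<^sub>\<rat> L \<rightarrow> A\<close> is bijective, which says that \<open>\<phi>\<close> carries \<open>\<rat>\<close>-bases of \<open>B\<close> injectively to
  \<open>L\<close>-bases of \<open>A\<close>. The product and unit of \<open>A\<close> are parameters because multiplication of the
  type of matrices is componentwise.
\<close>

definition scalar_extension ::
  "(rat \<Rightarrow> 'b::ring_1 \<Rightarrow> 'b) \<Rightarrow> ('l::field_char_0 \<Rightarrow> 'c::ab_group_add \<Rightarrow> 'c)
    \<Rightarrow> ('c \<Rightarrow> 'c \<Rightarrow> 'c) \<Rightarrow> 'c \<Rightarrow> ('b \<Rightarrow> 'c) \<Rightarrow> bool" where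
  "scalar_extension s t mul e \<phi> \<longleftrightarrow>
     (\<forall>x y. \<phi> (x + y) = \<phi> x + \<phi> y) \<and>
     (\<forall>r x. \<phi> (s r x) = t (of_rat r) (\<phi> x)) \<and>
     (\<forall>x y. \<phi> (x * y) = mul (\<phi> x) (\<phi> y)) \<and>
     \<phi> 1 = e \<and>
     (\<forall>E. is_basis s E \<longrightarrow> inj_on \<phi> E \<and> is_basis t (\<phi> ` E))"


section \<open>Quaternion algebras over the rationals\<close>

definition quaternion_algebra :: "(rat \<Rightarrow> 'b::ring_1 \<Rightarrow> 'b) \<Rightarrow> bool" where
  "quaternion_algebra s \<longleftrightarrow> unital_algebra s \<and>
     (\<exists>a b i j. a \<noteq> 0 \<and> b \<noteq> 0 \<and> i * i = s a 1 \<and> j * j = s b 1 \<and> j * i = - (i * j) \<and>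
        distinct [1, i, j, i * j] \<and> is_basis s {1, i, j, i * j})"

text \<open>
  Ramified at the infinite place: \<open>B \<otimes>\<^sub>\<rat> \<real>\<close> is a division algebra. The type \<open>'d\<close> is the
  carrier of that division algebra.
\<close>

definition ramified_at_infinity ::
  "'d::real_div_algebra itself \<Rightarrow> (rat \<Rightarrow> 'b::ring_1 \<Rightarrow> 'b) \<Rightarrow> bool" where
  "ramified_at_infinity _ s \<longleftrightarrow>
     (\<exists>\<phi> :: 'b \<Rightarrow> 'd. scalar_extension s (*\<^sub>R) (*) 1 \<phi>)"

definition standard_involution :: "(rat \<Rightarrow> 'b::ring_1 \<Rightarrow> 'b) \<Rightarrow> ('b \<Rightarrow> 'b) \<Rightarrow> bool" where
  "standard_involution s \<gamma> \<longleftrightarrow> Vector_Spaces.linear s s \<gamma> \<and> \<gamma> 1 = 1 \<and>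
     (\<forall>x y. \<gamma> (x * y) = \<gamma> y * \<gamma> x) \<and> (\<forall>x. \<gamma> (\<gamma> x) = x) \<and>
     (\<forall>x. \<exists>n. x * \<gamma> x = s n 1)"

text \<open>
  On a quaternion algebra there is exactly one standard involution, namely
  \<open>t + x i + y j + z ij \<mapsto> t - x i - y j - z ij\<close>, so the descriptions below are proper.
\<close>

definition conjugation :: "(rat \<Rightarrow> 'b::ring_1 \<Rightarrow> 'b) \<Rightarrow> 'b \<Rightarrow> 'b" where
  "conjugation s = (THE \<gamma>. standard_involution s \<gamma>)"

definition reduced_norm :: "(rat \<Rightarrow> 'b::ring_1 \<Rightarrow> 'b) \<Rightarrow> 'b \<Rightarrow> rat" where
  "reduced_norm s x = (THE n. x * conjugation s x = s n 1)"


section \<open>Involutions\<close>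

definition first_kind_involution :: "(rat \<Rightarrow> 'b::ring_1 \<Rightarrow> 'b) \<Rightarrow> ('b \<Rightarrow> 'b) \<Rightarrow> bool" where
  "first_kind_involution s \<sigma> \<longleftrightarrow>
     (\<forall>x y. \<sigma> (x + y) = \<sigma> x + \<sigma> y) \<and> (\<forall>x y. \<sigma> (x * y) = \<sigma> y * \<sigma> x) \<and>
     (\<forall>x. \<sigma> (\<sigma> x) = x) \<and> (\<forall>r. \<sigma> (s r 1) = s r 1)"

definition matrix_scale :: "'l::field \<Rightarrow> 'l^'n^'m \<Rightarrow> 'l^'n^'m" where
  "matrix_scale c M = (\<chi> i j. c * M $ i $ j)"

definition nondegenerate_symmetric_bilinear ::
  "('l::field^'n \<Rightarrow> 'l^'n \<Rightarrow> 'l) \<Rightarrow> bool" where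
  "nondegenerate_symmetric_bilinear b \<longleftrightarrow>
     (\<forall>v. Vector_Spaces.linear (*s) (*) (b v)) \<and> (\<forall>v w. b v w = b w v) \<and>
     (\<forall>v. (\<forall>w. b v w = 0) \<longrightarrow> v = 0)"

text \<open>
  The field \<open>'l\<close> splits \<open>B\<close>, and \<open>\<sigma> \<otimes> id\<close> becomes the adjoint involution of \<open>b\<close> on
  \<open>B \<otimes>\<^sub>\<rat> L \<cong> M\<^sub>2(L)\<close>. By linearity it is enough to require the adjointness on the image
  of \<open>B\<close>, which spans \<open>M\<^sub>2(L)\<close> over \<open>L\<close>.
\<close>

definition orthogonal_involution ::
  "'l::field_char_0 itself \<Rightarrow> (rat \<Rightarrow> 'b::ring_1 \<Rightarrow> 'b) \<Rightarrow> ('b \<Rightarrow> 'b) \<Rightarrow> bool" where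
  "orthogonal_involution _ s \<sigma> \<longleftrightarrow>
     (\<exists>(\<phi> :: 'b \<Rightarrow> 'l^2^2) b. scalar_extension s matrix_scale (**) (mat 1) \<phi> \<and>
        nondegenerate_symmetric_bilinear b \<and>
        (\<forall>x v w. b (\<phi> x *v v) w = b v (\<phi> (\<sigma> x) *v w)))"

definition represents_involution ::
  "(rat \<Rightarrow> 'b::ring_1 \<Rightarrow> 'b) \<Rightarrow> ('b \<Rightarrow> 'b) \<Rightarrow> 'b \<Rightarrow> bool" where
  "represents_involution s \<sigma> u \<longleftrightarrow> conjugation s u = - u \<and>
     (\<exists>u'. u * u' = 1 \<and> u' * u = 1 \<and> (\<forall>x. \<sigma> x = u * conjugation s x * u'))"

text \<open>
  The discriminant is the coset of \<open>- Nrd(u)\<close> modulo \<open>\<rat>\<^sup>*\<^sup>2\<close>, as a set of rationals. For an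
  orthogonal involution an element \<open>u\<close> exists and is unique up to a factor in \<open>\<rat>\<^sup>*\<close>, so the
  coset does not depend on the choice.
\<close>

definition discriminant :: "(rat \<Rightarrow> 'b::ring_1 \<Rightarrow> 'b) \<Rightarrow> ('b \<Rightarrow> 'b) \<Rightarrow> rat set" where
  "discriminant s \<sigma> =
     {- reduced_norm s (SOME u. represents_involution s \<sigma> u) * c\<^sup>2 | c. c \<noteq> 0}"


section \<open>The even Clifford algebra and imaginary quadratic fields\<close>

text \<open>\<open>\<rat>[X] / (X\<^sup>2 - \<delta>)\<close>, where \<open>\<delta>\<close> represents the discriminant of the involution.\<close>

definition even_clifford :: "rat \<Rightarrow> rat poly set ring" where
  "even_clifford \<delta> =
     (let P = (ring_of_type_algebra :: rat poly ring)
      in P Quot (PIdl\<^bsub>P\<^esub> [:- \<delta>, 0, 1:]))"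

text \<open>
  A field \<open>K\<close> of degree \<open>2\<close> over (the necessarily unique image of) \<open>\<rat>\<close> that has no
  embedding into \<open>\<real>\<close>.
\<close>

definition imaginary_quadratic_extension :: "('a, 'm) ring_scheme \<Rightarrow> bool" where
  "imaginary_quadratic_extension K \<longleftrightarrow> field K \<and>
     (\<exists>\<iota> \<in> ring_hom (ring_of_type_algebra :: rat ring) K.
        ring.dimension K 2 (range \<iota>) (carrier K)) \<and>
     ring_hom K (ring_of_type_algebra :: real ring) = {}"

end

theory Submission
  imports Defs
begin

text \<open>
  Write \<open>i\<^sup>2 = a\<close> and \<open>j\<^sup>2 = b\<close> for the generators of \<open>B\<close>. Extended to \<open>\<real>\<close>, the algebra has no
  zero divisors, so neither \<open>a\<close> nor \<open>b\<close> has a real square root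
  (\<open>ramified_imp_definite\<close>). Hence the reduced norm
  \<open>t\<^sup>2 - a x\<^sup>2 - b y\<^sup>2 + a b z\<^sup>2\<close> is positive definite. The discriminant of \<open>\<sigma>\<close> is the class of
  \<open>- Nrd u\<close> for an invertible \<open>u\<close> that represents \<open>\<sigma>\<close>, so every representative \<open>\<delta>\<close> is negative
  (\<open>discriminant_neg\<close>), and \<open>X\<^sup>2 - \<delta>\<close> generates an imaginary quadratic field
  (\<open>negative_quadratic.imaginary_quadratic\<close>).

  This argument needs a representing element. One is obtained from an explicit form of the
  Skolem--Noether theorem (\<open>intertwiner_exists\<close>) applied to the automorphism
  \<open>\<sigma> \<circ> \<gamma>\<close>, where \<open>\<gamma>\<close> is the conjugation: \<open>\<sigma> x = u * \<gamma> x * u\<^sup>-\<^sup>1\<close>, and \<open>\<sigma>\<^sup>2 = id\<close> leaves only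
  the cases that \<open>u\<close> is pure, as required, or rational. In the latter case \<open>\<sigma> = \<gamma>\<close>, which is
  impossible: \<open>\<gamma>\<close> negates the three-dimensional space of pure quaternions, whereas the skew-adjoint
  operators of a non-degenerate symmetric form on a plane are all proportional
  (\<open>skew_adjoint_proportional\<close>, \<open>qconj_not_orthogonal\<close>).
\<close>

text \<open>
  Both extensions of scalars, to \<open>\<real>\<close> and to a splitting field, are exploited through this fact: an
  extension carries a basis of \<open>B\<close> to a basis, so the images of distinct basis elements stay
  non-proportional.
\<close>

lemma is_basis_scaled_eq_imp_zero:
  assumes "vector_space s" and "is_basis s E" and "p \<in> E" "q \<in> E" "p \<noteq> q"
    and eq: "s c p = s d q"
  shows "c = 0"
proof -
  interpret vector_space s by fact
  have ind: "\<not> dependent E" using assms(2) by (simp add: is_basis_def)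
  have "(\<Sum>v\<in>{p, q}. s (if v = p then c else - d) v) = 0"
    using assms(5) eq by simp
  from independentD[OF ind _ _ this, of p] show ?thesis using assms(3-5) by auto
qed

section \<open>Coordinates, conjugation and reduced norm\<close>

locale quaternion_presentation = unital_algebra scale
  for scale :: "rat \<Rightarrow> 'b::ring_1 \<Rightarrow> 'b" +
  fixes a b :: rat and i j :: 'b
  assumes i_square: "i * i = scale a 1"
    and j_square: "j * j = scale b 1"
    and anticommute: "j * i = - (i * j)"
    and basis_distinct: "distinct [1, i, j, i * j]"
    and basis: "is_basis scale {1, i, j, i * j}"
begin

text \<open>
  Coordinates with respect to the basis \<open>1, i, j, ij\<close>; they reduce identities in the algebra to
  polynomial identities over \<open>\<rat>\<close>.
\<close>

definition quat :: "rat \<Rightarrow> rat \<Rightarrow> rat \<Rightarrow> rat \<Rightarrow> 'b" where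
  "quat t x y z = scale t 1 + scale x i + scale y j + scale z (i * j)"

lemma quat_cases:
  obtains t x y z where "w = quat t x y z"
proof -
  have "w \<in> span {1, i, j, i * j}"
    using basis by (simp add: is_basis_def)
  then obtain t x y z where "w - scale t 1 - scale x i - scale y j - scale z (i * j) = 0"
    by (auto simp: span_breakdown_eq)
  then have "w = quat t x y z"
    by (simp add: quat_def algebra_simps)
  then show thesis by (rule that)
qed

lemma quat_eq_0_iff: "quat t x y z = 0 \<longleftrightarrow> t = 0 \<and> x = 0 \<and> y = 0 \<and> z = 0"
proof
  assume *: "quat t x y z = 0"
  define c where "c v = (if v = 1 then t else if v = i then x else if v = j then y else z)" for v
  have ind: "independent {1, i, j, i * j}"
    using basis by (simp add: is_basis_def)
  have "(\<Sum>v\<in>{1, i, j, i * j}. scale (c v) v) = 0"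
    using * basis_distinct by (auto simp: c_def quat_def add.assoc)
  then have "c v = 0" if "v \<in> {1, i, j, i * j}" for v
    using independentD[OF ind _ order_refl] that by blast
  then have "c 1 = 0" "c i = 0" "c j = 0" "c (i * j) = 0" by auto
  then show "t = 0 \<and> x = 0 \<and> y = 0 \<and> z = 0"
    using basis_distinct by (auto simp: c_def)
qed (simp add: quat_def)

lemma quat_add: "quat t x y z + quat t' x' y' z' = quat (t + t') (x + x') (y + y') (z + z')"
  by (simp add: quat_def scale_left_distrib algebra_simps)

lemma quat_minus: "- quat t x y z = quat (- t) (- x) (- y) (- z)"
  by (simp add: quat_def algebra_simps)

lemma quat_diff: "quat t x y z - quat t' x' y' z' = quat (t - t') (x - x') (y - y') (z - z')"
  by (simp add: quat_def scale_left_diff_distrib algebra_simps)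

lemma quat_eq_iff:
  "quat t x y z = quat t' x' y' z' \<longleftrightarrow> t = t' \<and> x = x' \<and> y = y' \<and> z = z'"
proof -
  have "quat t x y z = quat t' x' y' z' \<longleftrightarrow> quat t x y z - quat t' x' y' z' = 0" by simp
  then show ?thesis unfolding quat_diff quat_eq_0_iff by auto
qed

lemma quat_scale: "scale r (quat t x y z) = quat (r * t) (r * x) (r * y) (r * z)"
  by (simp add: quat_def scale_right_distrib)

lemma quat_generators:
  "1 = quat 1 0 0 0" "i = quat 0 1 0 0" "j = quat 0 0 1 0" "i * j = quat 0 0 0 1"
  "scale r 1 = quat r 0 0 0" "0 = quat 0 0 0 0"
  by (simp_all add: quat_def)

lemma quat_mult:
  "quat t x y z * quat t' x' y' z' =
     quat (t * t' + a * x * x' + b * y * y' - a * b * z * z')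
       (t * x' + x * t' - b * y * z' + b * z * y')
       (t * y' + y * t' + a * x * z' - a * z * x')
       (t * z' + z * t' + x * y' - y * x')"
proof -
  have ik: "i * (i * j) = scale a j"
    by (simp add: mult.assoc[symmetric] i_square scale_mult_left)
  have kj: "(i * j) * j = scale b i"
    by (simp add: mult.assoc j_square scale_mult_right)
  have jk: "j * (i * j) = - scale b i"
    by (simp add: mult.assoc[symmetric] anticommute) (simp add: kj)
  have ki: "(i * j) * i = - scale a j"
    by (simp add: mult.assoc anticommute ik)
  have "(i * j) * (i * j) = i * (j * (i * j))" by (simp add: mult.assoc)
  also have "\<dots> = - scale (a * b) 1"
    by (simp add: jk scale_mult_right i_square mult.commute)
  finally have kk: "(i * j) * (i * j) = - scale (a * b) 1" .
  show ?thesis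
    unfolding quat_def
    by (simp add: distrib_left distrib_right scale_mult_left scale_mult_right
        i_square j_square anticommute ik kj jk ki kk
        scale_left_distrib scale_left_diff_distrib scale_right_distrib)
      (simp add: algebra_simps)
qed

text \<open>
  Quaternion conjugation in coordinates. The description is proper because coordinates are
  unique; the formula follows in \<open>qconj_quat\<close>.
\<close>

definition qconj :: "'b \<Rightarrow> 'b" where
  "qconj w = (THE w'. \<exists>t x y z. w = quat t x y z \<and> w' = quat t (- x) (- y) (- z))"

lemma qconj_quat [simp]: "qconj (quat t x y z) = quat t (- x) (- y) (- z)"
  unfolding qconj_def by (rule the_equality) (auto simp: quat_eq_iff)

lemma linear_qconj: "Vector_Spaces.linear scale scale qconj"
proof -
  have "qconj (v + w) = qconj v + qconj w" for v w
    by (cases v rule: quat_cases, cases w rule: quat_cases) (simp add: quat_add)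
  moreover have "qconj (scale r w) = scale r (qconj w)" for r w
    by (cases w rule: quat_cases) (simp add: quat_scale)
  ultimately show ?thesis
    by (simp add: Vector_Spaces.linear_iff vector_space_axioms)
qed

lemma qconj_mult: "qconj (v * w) = qconj w * qconj v"
  by (cases v rule: quat_cases, cases w rule: quat_cases)
    (simp add: quat_mult quat_eq_iff algebra_simps)

lemma mult_qconj: "quat t x y z * qconj (quat t x y z) = scale (t\<^sup>2 - a * x\<^sup>2 - b * y\<^sup>2 + a * b * z\<^sup>2) 1"
  unfolding quat_generators(5) qconj_quat quat_mult quat_eq_iff
  by (simp add: power2_eq_square algebra_simps)

lemma standard_involution_qconj: "standard_involution scale qconj"
proof -
  have "qconj (qconj w) = w" for w
    by (cases w rule: quat_cases) simp
  moreover have "\<exists>n. w * qconj w = scale n 1" for w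
    by (cases w rule: quat_cases) (auto simp only: mult_qconj)
  moreover have "qconj 1 = 1"
    by (simp add: quat_generators(1) del: One_nat_def)
  ultimately show ?thesis
    by (simp add: standard_involution_def linear_qconj qconj_mult)
qed

text \<open>
  Comparing the norms of \<open>w\<close> and \<open>w + 1\<close> shows that a standard involution sends \<open>w\<close> to
  \<open>r - w\<close> for some rational \<open>r\<close>. If \<open>w\<close> is pure and nonzero, then \<open>w\<^sup>2\<close> is rational, hence so is
  \<open>r w\<close>, and therefore \<open>r = 0\<close>. Consequently the involution negates pure quaternions.
\<close>

lemma standard_involution_unique:
  assumes "standard_involution scale \<gamma>"
  shows "\<gamma> = qconj"
proof
  from assms have lin: "Vector_Spaces.linear scale scale \<gamma>" and one: "\<gamma> 1 = 1"
    and norm: "\<And>w. \<exists>n. w * \<gamma> w = scale n 1"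
    by (auto simp: standard_involution_def)
  interpret \<gamma>: Vector_Spaces.linear scale scale \<gamma> by fact
  have trace: "\<exists>r. \<gamma> w = scale r 1 - w" for w
  proof -
    obtain m n where mn: "(w + 1) * \<gamma> (w + 1) = scale m 1" "w * \<gamma> w = scale n 1"
      using norm by metis
    have "(w + 1) * \<gamma> (w + 1) = w * \<gamma> w + w + \<gamma> w + 1"
      by (simp add: \<gamma>.add one algebra_simps)
    then have "\<gamma> w = scale m 1 - scale n 1 - 1 - w"
      using mn by (simp add: algebra_simps)
    also have "\<dots> = scale (m - n - 1) 1 - w"
      by (simp add: scale_left_diff_distrib)
    finally show ?thesis by blast
  qed
  have pure: "\<gamma> (quat 0 x y z) = - quat 0 x y z" for x y z
  proof (cases "x = 0 \<and> y = 0 \<and> z = 0")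
    case True
    then show ?thesis by (simp add: quat_generators(6)[symmetric])
  next
    case False
    obtain r where r: "\<gamma> (quat 0 x y z) = scale r 1 - quat 0 x y z"
      using trace by blast
    obtain n where "quat 0 x y z * \<gamma> (quat 0 x y z) = scale n 1"
      using norm by blast
    then have "r * x = 0 \<and> r * y = 0 \<and> r * z = 0"
      unfolding r quat_generators(5) quat_diff quat_mult quat_eq_iff
      by (simp add: algebra_simps)
    then have "r = 0" using False by auto
    then show ?thesis using r by simp
  qed
  fix w
  obtain t x y z where w: "w = quat t x y z" by (rule quat_cases)
  have "w = scale t 1 + quat 0 x y z"
    by (simp add: w quat_def algebra_simps)
  then have "\<gamma> w = scale t 1 - quat 0 x y z"
    by (simp add: \<gamma>.add \<gamma>.scale one pure)
  also have "\<dots> = qconj w"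
    by (simp add: w quat_generators(5) quat_diff)
  finally show "\<gamma> w = qconj w" .
qed

lemma conjugation_eq: "conjugation scale = qconj"
  unfolding conjugation_def
  using standard_involution_qconj standard_involution_unique by (rule the_equality)

lemma reduced_norm_quat:
  "reduced_norm scale (quat t x y z) = t\<^sup>2 - a * x\<^sup>2 - b * y\<^sup>2 + a * b * z\<^sup>2"
  unfolding reduced_norm_def conjugation_eq mult_qconj
  by (rule the_equality) (simp_all add: quat_generators(5) quat_eq_iff)

lemma mult_qconj_eq_reduced_norm: "w * qconj w = scale (reduced_norm scale w) 1"
  by (cases w rule: quat_cases) (simp add: mult_qconj reduced_norm_quat del: qconj_quat)

lemma qconj_mult_eq_reduced_norm: "qconj w * w = scale (reduced_norm scale w) 1"
proof (cases w rule: quat_cases)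
  case (1 t x y z)
  then show ?thesis
    unfolding reduced_norm_quat 1 qconj_quat quat_generators(5) quat_mult quat_eq_iff
    by (simp add: power2_eq_square algebra_simps)
qed

lemma central_imp_scalar:
  assumes "a \<noteq> 0" and "w * i = i * w" "w * j = j * w"
  shows "\<exists>r. w = scale r 1"
proof (cases w rule: quat_cases)
  case (1 t x y z)
  from assms(2) have "a * z = 0 \<and> y = 0"
    unfolding 1 by (subst (asm) (1 2) quat_generators(2)) (simp add: quat_mult quat_eq_iff)
  moreover from assms(3) have "x = 0"
    unfolding 1 by (subst (asm) (1 2) quat_generators(3)) (simp add: quat_mult quat_eq_iff)
  ultimately show ?thesis
    using 1 assms(1) by (auto simp: quat_generators(5))
qed

section \<open>Existence of a representing element\<close>

text \<open>
  The Skolem--Noether theorem, by averaging. For every \<open>y\<close> the element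
  \<open>u y = (\<Sum>g \<in> {1, i, j, ij}. \<alpha> g * y * g\<^sup>-\<^sup>1)\<close> intertwines the identity and \<open>\<alpha>\<close>, because
  multiplication by \<open>i\<close> or \<open>j\<close> permutes the four basis elements up to scalars, which cancel
  in each summand. Some \<open>u y\<close> is nonzero: \<open>(\<Sum>g. u (g\<^sup>-\<^sup>1) * g) = 4\<close>, since two basis
  elements commute or anticommute, and each one other than \<open>1\<close> anticommutes with exactly two of the
  four, so that all terms containing \<open>\<alpha> h\<close> with \<open>h \<noteq> 1\<close> cancel.
\<close>

lemma intertwiner_exists:
  assumes ab: "a \<noteq> 0" "b \<noteq> 0"
    and lin: "Vector_Spaces.linear scale scale \<alpha>"
    and mult: "\<And>v w. \<alpha> (v * w) = \<alpha> v * \<alpha> w" and one: "\<alpha> 1 = 1"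
  obtains u where "u \<noteq> 0" "\<And>x. \<alpha> x * u = u * x"
proof -
  interpret \<alpha>: Vector_Spaces.linear scale scale \<alpha> by fact
  define i' j' A B where "i' = scale (1 / a) i" and "j' = scale (1 / b) j"
    and "A = \<alpha> i" and "B = \<alpha> j"
  have i: "i = scale a i'" and j: "j = scale b j'"
    using ab by (simp_all add: i'_def j'_def)
  have ii: "i' * i' = scale (1 / a) 1" and jj: "j' * j' = scale (1 / b) 1" and ji: "j' * i' = - (i' * j')"
    using ab by (simp_all add: i'_def j'_def scale_mult_left scale_mult_right i_square j_square anticommute)
  have AA: "A * A = scale a 1" and BB: "B * B = scale b 1" and BA: "B * A = - (A * B)"
    using \<alpha>.scale[of _ 1] \<alpha>.neg
    by (simp_all add: A_def B_def mult[symmetric] i_square j_square anticommute one)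
  have push: "i' * (i' * w) = scale (1 / a) w" "j' * (j' * w) = scale (1 / b) w" "j' * (i' * w) = - (i' * (j' * w))"
    "A * (A * w) = scale a w" "B * (B * w) = scale b w" "B * (A * w) = - (A * (B * w))" for w
    using ii jj ji AA BB BA by (simp_all add: mult.assoc[symmetric] scale_mult_left)
  \<comment> \<open>These rules move every word into the form (word in \<open>A\<close>, \<open>B\<close>) \<open>y\<close> (word in \<open>i'\<close>, \<open>j'\<close>)
    with sorted words that contain each letter at most once.\<close>
  note normalise = algebra_simps scale_mult_left scale_mult_right
    ii jj ji AA BB BA push
  define u where "u y = y + A * y * i' + B * y * j' + A * B * y * j' * i'" for y
  have u_i: "A * u y = u y * i" for y
    unfolding u_def by (subst i) (use ab in \<open>simp add: normalise\<close>)
  have u_j: "B * u y = u y * j" for y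
    unfolding u_def by (subst j) (use ab in \<open>simp add: normalise\<close>)
  have "scale 4 1 = scale (1 + 1 + 1 + 1) 1" by simp
  also have "\<dots> = 1 + 1 + 1 + 1" by (simp only: scale_left_distrib scale_one)
  finally have four: "scale 4 1 = (4 :: 'b)" by simp
  have "u 1 + u i' * i + u j' * j + u (j' * i') * i * j = scale 4 1"
    unfolding u_def i j by (use ab in \<open>simp add: normalise four\<close>)
  moreover have "scale 4 1 \<noteq> (0 :: 'b)" by simp
  ultimately obtain y where y: "u y \<noteq> 0"
    by (metis add_0 mult_zero_left)
  have "\<alpha> x * u y = u y * x" for x
  proof (cases x rule: quat_cases)
    case (1 t p q r)
    have "A * B * u y = u y * i * j"
      by (simp add: mult.assoc u_i u_j) (simp add: mult.assoc[symmetric] u_i)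
    then show ?thesis
      unfolding 1 quat_def
      by (simp add: \<alpha>.add \<alpha>.scale mult one A_def[symmetric] B_def[symmetric] distrib_left distrib_right
          scale_mult_left scale_mult_right u_i u_j mult.assoc)
  qed
  with y show thesis by (rule that)
qed

end

locale definite_quaternion_presentation = quaternion_presentation scale a b i j
  for scale :: "rat \<Rightarrow> 'b::ring_1 \<Rightarrow> 'b" and a b i j +
  assumes a_neg: "a < 0" and b_neg: "b < 0"
begin

lemma reduced_norm_pos:
  assumes "w \<noteq> 0"
  shows "reduced_norm scale w > 0"
proof (cases w rule: quat_cases)
  case (1 t x y z)
  have ab: "a * b > 0" using a_neg b_neg by (rule mult_neg_neg)
  have nonneg: "t\<^sup>2 \<ge> 0" "- a * x\<^sup>2 \<ge> 0" "- b * y\<^sup>2 \<ge> 0" "a * b * z\<^sup>2 \<ge> 0"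
    using a_neg b_neg ab by (simp_all add: mult_nonpos_nonneg)
  have "t\<^sup>2 > 0 \<or> - a * x\<^sup>2 > 0 \<or> - b * y\<^sup>2 > 0 \<or> a * b * z\<^sup>2 > 0"
    using assms a_neg b_neg ab unfolding 1 quat_eq_0_iff
    by (auto simp: mult_less_0_iff zero_less_mult_iff)
  with nonneg have "t\<^sup>2 + - a * x\<^sup>2 + - b * y\<^sup>2 + a * b * z\<^sup>2 > 0"
    by linarith
  then show ?thesis by (simp add: 1 reduced_norm_quat)
qed

lemma inverse_exists:
  fixes w :: 'b
  assumes "w \<noteq> 0"
  obtains w' where "w * w' = 1" "w' * w = 1"
proof
  let ?n = "reduced_norm scale w"
  show "w * scale (1 / ?n) (qconj w) = 1" "scale (1 / ?n) (qconj w) * w = 1"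
    using reduced_norm_pos[OF assms]
    by (simp_all add: scale_mult_left scale_mult_right mult_qconj_eq_reduced_norm qconj_mult_eq_reduced_norm)
qed

text \<open>
  The map \<open>\<sigma> \<circ> qconj\<close> is an automorphism, so it is conjugation by some \<open>u\<close>, and
  \<open>\<sigma> x = u * qconj x * u\<^sup>-\<^sup>1\<close>. From \<open>\<sigma> \<circ> \<sigma> = id\<close> it follows that \<open>qconj u * u\<^sup>-\<^sup>1\<close> is central, hence
  a scalar \<open>c\<close>. In coordinates, \<open>qconj u = c u\<close> means that \<open>u\<close> is pure or rational; a rational \<open>u\<close>
  would give \<open>\<sigma> = qconj\<close>.
\<close>

lemma represents_involution_exists:
  assumes \<sigma>: "first_kind_involution scale \<sigma>" and ne: "\<sigma> \<noteq> qconj"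
  shows "\<exists>u. represents_involution scale \<sigma> u"
proof -
  from \<sigma> have add: "\<And>v w. \<sigma> (v + w) = \<sigma> v + \<sigma> w" and mult: "\<And>v w. \<sigma> (v * w) = \<sigma> w * \<sigma> v"
    and invol: "\<And>w. \<sigma> (\<sigma> w) = w" and scalar: "\<And>r. \<sigma> (scale r 1) = scale r 1"
    by (auto simp: first_kind_involution_def)
  interpret qconj: Vector_Spaces.linear scale scale qconj by (rule linear_qconj)
  have conj_conj: "qconj (qconj w) = w" for w
    using standard_involution_qconj by (simp add: standard_involution_def)
  have conj_one: "qconj 1 = 1"
    using standard_involution_qconj by (simp add: standard_involution_def)
  have \<sigma>_scale: "\<sigma> (scale r w) = scale r (\<sigma> w)" for r w
    using mult[of w "scale r 1"] by (simp add: scalar scale_mult_left scale_mult_right)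
  have "Vector_Spaces.linear scale scale (\<lambda>w. \<sigma> (qconj w))"
    by (simp add: Vector_Spaces.linear_iff vector_space_axioms qconj.add qconj.scale add \<sigma>_scale)
  moreover have "\<sigma> (qconj (v * w)) = \<sigma> (qconj v) * \<sigma> (qconj w)" for v w
    by (simp add: qconj_mult mult)
  moreover have "\<sigma> (qconj 1) = 1"
    using scalar[of 1] by (simp add: conj_one)
  ultimately obtain u where "u \<noteq> 0" and u: "\<And>x. \<sigma> (qconj x) * u = u * x"
    using intertwiner_exists[of "\<lambda>w. \<sigma> (qconj w)"] a_neg b_neg by blast
  then obtain u' where u': "u * u' = 1" "u' * u = 1" using inverse_exists by blast
  have \<sigma>_eq: "\<sigma> x = u * qconj x * u'" for x
  proof -
    have "\<sigma> x = \<sigma> (qconj (qconj x)) * u * u'"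
      by (simp add: conj_conj mult.assoc u')
    then show ?thesis by (simp only: u)
  qed
  have conj_u: "qconj u * qconj u' = 1" "qconj u' * qconj u = 1"
    using u' by (simp_all add: qconj_mult[symmetric] conj_one)
  have central: "x * (qconj u * u') = (qconj u * u') * x" for x
  proof -
    have "x = u * qconj (u * qconj x * u') * u'"
      using invol[of x] by (simp add: \<sigma>_eq)
    also have "\<dots> = u * qconj u' * (x * (qconj u * u'))"
      by (simp add: qconj_mult conj_conj mult.assoc)
    finally have "x = u * qconj u' * (x * (qconj u * u'))" .
    then have "(qconj u * u') * x = (qconj u * u') * (u * qconj u' * (x * (qconj u * u')))"
      by (rule arg_cong)
    also have "\<dots> = qconj u * (u' * u) * qconj u' * (x * (qconj u * u'))"
      by (simp only: mult.assoc)
    finally show ?thesis by (simp add: u' conj_u)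
  qed
  then obtain c where c: "qconj u * u' = scale c 1"
    using central_imp_scalar[of "qconj u * u'"] a_neg b_neg by auto
  have "qconj u = qconj u * u' * u" by (simp add: mult.assoc u')
  then have cu: "qconj u = scale c u" by (simp add: c scale_mult_left)
  have "qconj u = - u"
  proof (cases u rule: quat_cases)
    case (1 t x y z)
    show ?thesis
    proof (cases "t = 0")
      case True
      then show ?thesis by (simp add: 1 quat_minus)
    next
      case False
      with cu have "c = 1" by (simp add: 1 quat_scale quat_eq_iff)
      with cu have "u = scale t 1" by (simp add: 1 quat_scale quat_eq_iff quat_generators(5))
      then have "\<sigma> x = qconj x * (u * u')" for x
        by (simp add: \<sigma>_eq scale_mult_left scale_mult_right)
      then have "\<sigma> = qconj" by (simp add: fun_eq_iff u')
      with ne show ?thesis by contradiction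
    qed
  qed
  then show ?thesis
    using u' \<sigma>_eq by (auto simp: represents_involution_def conjugation_eq)
qed

end

section \<open>Conjugation is not orthogonal\<close>

lemma vector_space_matrix_scale: "vector_space (matrix_scale :: 'l::field \<Rightarrow> 'l^'n^'m \<Rightarrow> _)"
  by unfold_locales (simp_all add: matrix_scale_def vec_eq_iff algebra_simps)

lemma matrix_scale_mult_vec: "matrix_scale c M *v v = c *s (M *v v)"
  by (simp add: matrix_scale_def matrix_vector_mult_def vec_eq_iff sum_distrib_left mult.assoc)

text \<open>
  If \<open>M\<close> is skew-adjoint for a symmetric form, then \<open>\<beta> (M v) w\<close> is an alternating form in \<open>v\<close> and
  \<open>w\<close>. Alternating forms on the plane form a line, and non-degeneracy of \<open>\<beta>\<close> recovers \<open>M\<close> from its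
  alternating form, so skew-adjoint operators form a space of dimension at most one.
\<close>

lemma skew_adjoint_proportional:
  fixes \<beta> :: "'l::field_char_0^2 \<Rightarrow> 'l^2 \<Rightarrow> 'l"
  assumes \<beta>: "nondegenerate_symmetric_bilinear \<beta>"
    and P: "\<And>v w. \<beta> (P *v v) w = - \<beta> v (P *v w)"
    and Q: "\<And>v w. \<beta> (Q *v v) w = - \<beta> v (Q *v w)"
  obtains c d where "c \<noteq> 0 \<or> d \<noteq> 0" "matrix_scale c P = matrix_scale d Q"
proof -
  from \<beta> have lin: "\<And>v. Vector_Spaces.linear (*s) (*) (\<beta> v)" and sym: "\<And>v w. \<beta> v w = \<beta> w v"
    and nondeg: "\<And>v. (\<And>w. \<beta> v w = 0) \<Longrightarrow> v = 0"
    by (auto simp: nondegenerate_symmetric_bilinear_def)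
  have add: "\<beta> v (w + w') = \<beta> v w + \<beta> v w'" and scale: "\<beta> v (r *s w) = r * \<beta> v w" for v w w' r
    using lin[of v] by (simp_all add: Vector_Spaces.linear_iff)
  let ?e = "axis 1 1 :: 'l^2" and ?f = "axis 2 1 :: 'l^2"
  have expand: "v = v $ 1 *s ?e + v $ 2 *s ?f" for v :: "'l^2"
    by (simp add: vec_eq_iff forall_2 axis_def)
  \<comment> \<open>A skew-adjoint operator is determined by a single matrix entry of its alternating form.\<close>
  have kill: "M = 0" if M: "\<And>v w. \<beta> (M *v v) w = - \<beta> v (M *v w)" and ef: "\<beta> (M *v ?e) ?f = 0" for M :: "'l^2^2"
  proof -
    have diag: "\<beta> (M *v v) v = 0" for v
    proof -
      have "\<beta> (M *v v) v = - \<beta> v (M *v v)" by (rule M)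
      also have "\<beta> v (M *v v) = \<beta> (M *v v) v" by (rule sym)
      finally have "2 * \<beta> (M *v v) v = 0" by (simp only: mult_2 eq_neg_iff_add_eq_0)
      then show ?thesis by simp
    qed
    have fe: "\<beta> (M *v ?f) ?e = 0"
    proof -
      have "\<beta> (M *v ?f) ?e = - \<beta> ?f (M *v ?e)" by (rule M)
      also have "\<beta> ?f (M *v ?e) = \<beta> (M *v ?e) ?f" by (rule sym)
      finally show ?thesis by (simp only: ef) simp
    qed
    have zero: "M *v v = 0" if "\<beta> (M *v v) ?e = 0" "\<beta> (M *v v) ?f = 0" for v
    proof (rule nondeg)
      fix w
      show "\<beta> (M *v v) w = 0"
        by (subst expand[of w]) (simp add: add scale that)
    qed
    have "M *v ?e = 0" using diag ef by (rule zero)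
    moreover have "M *v ?f = 0" using fe diag by (rule zero)
    ultimately have "M *v v = 0" for v
      by (subst expand[of v]) (simp only: matrix_vector_right_distrib vector_scalar_commute
          vector_smult_rzero add_0)
    then show ?thesis by (simp add: matrix_eq)
  qed
  show thesis
  proof (cases "\<beta> (P *v ?e) ?f = 0")
    case True
    with P have "P = 0" by (rule kill)
    then have "matrix_scale 1 P = matrix_scale 0 Q"
      by (simp add: matrix_scale_def vec_eq_iff)
    then show thesis by (intro that[of 1 0]) auto
  next
    case False
    define c d where "c = \<beta> (Q *v ?e) ?f" and "d = \<beta> (P *v ?e) ?f"
    \<comment> \<open>The combination is chosen so that the entry \<open>\<beta> (M e) f\<close> cancels.\<close>
    define M where "M = matrix_scale c P - matrix_scale d Q"
    have Mv: "M *v v = c *s (P *v v) + (- d) *s (Q *v v)" for v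
      by (simp add: M_def matrix_vector_mult_diff_rdistrib matrix_scale_mult_vec)
    have \<beta>M: "\<beta> w (M *v v) = c * \<beta> w (P *v v) - d * \<beta> w (Q *v v)" for v w
      unfolding Mv add scale by simp
    have "\<beta> (M *v v) w = - \<beta> v (M *v w)" for v w
      using P[of v w] Q[of v w] by (simp only: sym[of _ w] \<beta>M) (simp add: algebra_simps)
    moreover have "\<beta> (M *v ?e) ?f = 0"
      by (simp only: sym[of _ ?f] \<beta>M c_def d_def) simp
    ultimately have "M = 0" by (rule kill)
    then have "matrix_scale c P = matrix_scale d Q" by (simp add: M_def)
    then show thesis using False by (intro that[of c d]) (auto simp: d_def)
  qed
qed

lemma scalar_extensionD:
  assumes "scalar_extension s t mul e \<phi>"
  shows "\<phi> (s r x) = t (of_rat r) (\<phi> x)" "\<phi> (x * y) = mul (\<phi> x) (\<phi> y)" "\<phi> 1 = e"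
    "is_basis s E \<Longrightarrow> inj_on \<phi> E" "is_basis s E \<Longrightarrow> is_basis t (\<phi> ` E)"
  using assms unfolding scalar_extension_def by blast+

text \<open>
  Conjugation negates both \<open>i\<close> and \<open>j\<close>. If it were adjoint to a non-degenerate symmetric form, then the images of
  \<open>i\<close> and \<open>j\<close> would be skew-adjoint and hence proportional, but they belong to a basis.
\<close>

lemma (in quaternion_presentation) qconj_not_orthogonal:
  "\<not> orthogonal_involution TYPE('l::field_char_0) scale qconj"
proof
  assume "orthogonal_involution TYPE('l) scale qconj"
  then obtain \<phi> :: "'b \<Rightarrow> 'l^2^2" and \<beta>
    where \<phi>: "scalar_extension scale matrix_scale (**) (mat 1) \<phi>"
      and \<beta>: "nondegenerate_symmetric_bilinear \<beta>"
      and adj: "\<And>x v w. \<beta> (\<phi> x *v v) w = \<beta> v (\<phi> (qconj x) *v w)"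
    unfolding orthogonal_involution_def by blast
  note \<phi>D = scalar_extensionD[OF \<phi>]
  have inj: "inj_on \<phi> {1, i, j, i * j}"
    and \<phi>_basis: "is_basis matrix_scale (\<phi> ` {1, i, j, i * j})"
    and \<phi>_scale: "\<And>r x. \<phi> (scale r x) = matrix_scale (of_rat r) (\<phi> x)"
    by (rule \<phi>D(4)[OF basis], rule \<phi>D(5)[OF basis], rule \<phi>D(1))
  have \<phi>_minus: "\<phi> (- x) *v w = - (\<phi> x *v w)" for x w
    using \<phi>_scale[of "- 1" x] by (simp add: matrix_scale_mult_vec)
  have \<beta>_minus: "\<beta> v (- w) = - \<beta> v w" for v w
  proof -
    have "\<beta> v ((- 1) *s w) = (- 1) * \<beta> v w"
      using \<beta> unfolding nondegenerate_symmetric_bilinear_def Vector_Spaces.linear_iff by blast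
    then show ?thesis by simp
  qed
  have conj_ij: "qconj i = - i" "qconj j = - j"
    using qconj_quat[of 0 1 0 0] quat_minus[of 0 1 0 0] qconj_quat[of 0 0 1 0] quat_minus[of 0 0 1 0]
    by (simp_all only: quat_generators(2,3)[symmetric] minus_zero)
  have skew: "\<beta> (\<phi> x *v v) w = - \<beta> v (\<phi> x *v w)" if "x \<in> {i, j}" for x v w
    using that adj[of x v w] conj_ij by (auto simp: \<phi>_minus \<beta>_minus)
  obtain c d where cd: "c \<noteq> 0 \<or> d \<noteq> 0" "matrix_scale c (\<phi> i) = matrix_scale d (\<phi> j)"
    using skew_adjoint_proportional[OF \<beta>, of "\<phi> i" "\<phi> j"] skew by blast
  have "\<phi> i \<noteq> \<phi> j"
    using inj basis_distinct by (auto simp: inj_on_eq_iff)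
  then have "c = 0" "d = 0"
    using is_basis_scaled_eq_imp_zero[OF vector_space_matrix_scale \<phi>_basis _ _ _ cd(2)]
      is_basis_scaled_eq_imp_zero[OF vector_space_matrix_scale \<phi>_basis _ _ _ cd(2)[symmetric]]
    by auto
  with cd(1) show False by simp
qed

section \<open>Ramification and the sign of the discriminant\<close>

text \<open>
  For \<open>r \<ge> 0\<close> the element \<open>x\<^sup>2 - r\<close> factors over \<open>\<real>\<close>, and a division algebra has no zero
  divisors.
\<close>

lemma real_algebra_square_neg:
  fixes x :: "'d::real_div_algebra"
  assumes sq: "x * x = of_real r" and nonreal: "\<And>c. x \<noteq> of_real c"
  shows "r < 0"
proof (rule ccontr)
  assume "\<not> r < 0"
  then have "of_real (sqrt r) * of_real (sqrt r) = (of_real r :: 'd)"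
    by (simp flip: of_real_mult)
  moreover have "x * of_real (sqrt r) = of_real (sqrt r) * x"
    by (simp add: of_real_def)
  ultimately have "(x - of_real (sqrt r)) * (x + of_real (sqrt r)) = 0"
    using sq by (simp add: algebra_simps)
  then have "x = of_real (sqrt r) \<or> x = of_real (- sqrt r)"
    by (auto simp: eq_neg_iff_add_eq_0)
  with nonreal show False by blast
qed

lemma (in quaternion_presentation) ramified_imp_definite:
  assumes "ramified_at_infinity TYPE('d::real_div_algebra) scale"
  shows "a < 0" "b < 0"
proof -
  from assms obtain \<phi> :: "'b \<Rightarrow> 'd" where \<phi>: "scalar_extension scale (*\<^sub>R) (*) 1 \<phi>"
    unfolding ramified_at_infinity_def by blast
  note \<phi>D = scalar_extensionD[OF \<phi>]
  have inj: "inj_on \<phi> {1, i, j, i * j}"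
    and \<phi>_basis: "is_basis (*\<^sub>R) (\<phi> ` {1, i, j, i * j})"
    and \<phi>_scale: "\<And>r x. \<phi> (scale r x) = of_rat r *\<^sub>R \<phi> x"
    and \<phi>_mult: "\<And>x y. \<phi> (x * y) = \<phi> x * \<phi> y" and \<phi>_1: "\<phi> 1 = 1"
    by (rule \<phi>D(4)[OF basis], rule \<phi>D(5)[OF basis], rule \<phi>D(1), rule \<phi>D(2), rule \<phi>D(3))
  have neg: "r < 0" if x: "x \<in> {i, j}" and sq: "x * x = scale r 1" for x r
  proof -
    have "\<phi> x * \<phi> x = of_real (of_rat r)"
      unfolding \<phi>_mult[symmetric] sq \<phi>_scale \<phi>_1 by (simp add: of_real_def)
    moreover have "\<phi> x \<noteq> of_real c" for c
    proof
      assume "\<phi> x = of_real c"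
      then have eq: "1 *\<^sub>R \<phi> x = c *\<^sub>R \<phi> 1" by (simp add: of_real_def \<phi>_1)
      have "\<phi> x \<noteq> \<phi> 1"
        using inj basis_distinct x by (auto simp: inj_on_eq_iff)
      then show False
        using is_basis_scaled_eq_imp_zero[OF real_vector.vector_space_axioms \<phi>_basis _ _ _ eq] x by auto
    qed
    ultimately have "(of_rat r :: real) < 0" by (rule real_algebra_square_neg)
    then show ?thesis by simp
  qed
  from neg[OF _ i_square] neg[OF _ j_square] show "a < 0" "b < 0" by auto
qed

text \<open>
  The discriminant is defined through a choice of representing element. Because a representing
  element exists, the chosen one represents \<open>\<sigma>\<close>; it is invertible, and its reduced norm is positive.
\<close>

lemma discriminant_neg:
  fixes scale :: "rat \<Rightarrow> 'b::ring_1 \<Rightarrow> 'b"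
  assumes quat: "quaternion_algebra scale"
    and ram: "ramified_at_infinity TYPE('d::real_div_algebra) scale"
    and \<sigma>: "first_kind_involution scale \<sigma>"
    and orth: "orthogonal_involution TYPE('l::field_char_0) scale \<sigma>"
    and \<delta>: "\<delta> \<in> discriminant scale \<sigma>"
  shows "\<delta> < 0"
proof -
  from quat obtain a b i j where "quaternion_presentation scale a b i j"
    unfolding quaternion_algebra_def quaternion_presentation_def quaternion_presentation_axioms_def
    by blast
  then interpret quaternion_presentation scale a b i j .
  interpret definite_quaternion_presentation scale a b i j
    using ramified_imp_definite[OF ram] by unfold_locales
  have "\<sigma> \<noteq> qconj"
    using orth qconj_not_orthogonal by blast
  define u where "u = (SOME u. represents_involution scale \<sigma> u)"
  have "represents_involution scale \<sigma> u"
    unfolding u_def using represents_involution_exists[OF \<sigma> \<open>\<sigma> \<noteq> qconj\<close>] by (rule someI_ex)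
  then have "u \<noteq> 0"
    by (auto simp: represents_involution_def)
  then have pos: "reduced_norm scale u > 0" by (rule reduced_norm_pos)
  from \<delta> obtain c where "c \<noteq> 0" "\<delta> = - reduced_norm scale u * c\<^sup>2"
    unfolding discriminant_def u_def by blast
  with pos show ?thesis by simp
qed


section \<open>Quadratic extensions by the root of a negative rational\<close>

lemma ring_of_type_algebra_simps [simp]:
  "carrier ring_of_type_algebra = UNIV"
  "x \<otimes>\<^bsub>ring_of_type_algebra\<^esub> y = x * y"
  "x \<oplus>\<^bsub>ring_of_type_algebra\<^esub> y = x + y"
  "\<one>\<^bsub>ring_of_type_algebra\<^esub> = 1"
  "\<zero>\<^bsub>ring_of_type_algebra\<^esub> = 0"
  by (simp_all add: ring_of_type_algebra_def)

text \<open>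
  A unital homomorphism fixes the natural numbers, and a positive rational is a quotient of two
  positive ones.
\<close>

lemma rat_ring_hom_real_pos:
  fixes f :: "rat \<Rightarrow> real"
  assumes add: "\<And>x y. f (x + y) = f x + f y" and mult: "\<And>x y. f (x * y) = f x * f y"
    and one: "f 1 = 1" and r: "r > 0"
  shows "f r > 0"
proof -
  have zero: "f 0 = 0" using add[of 0 0] by simp
  have nat: "f (of_nat n) = of_nat n" for n
    by (induction n) (simp_all add: zero add one)
  obtain m n :: int where mn: "r = of_int m / of_int n" "n > 0"
    by (cases r) (auto simp: Fract_of_int_quotient)
  with r have "m > 0" by (simp add: zero_less_divide_iff)
  have "r * of_nat (nat n) = of_nat (nat m)"
    using mn \<open>m > 0\<close> by simp
  then have "f r * of_nat (nat n) = of_nat (nat m)"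
    using mult[of r "of_nat (nat n)"] by (simp add: nat)
  moreover have "(of_nat (nat m) :: real) > 0" "(of_nat (nat n) :: real) > 0"
    using \<open>m > 0\<close> \<open>n > 0\<close> by simp_all
  ultimately show ?thesis by (metis zero_less_mult_pos2)
qed

locale negative_quadratic =
  fixes \<delta> :: rat
  assumes neg: "\<delta> < 0"
begin

abbreviation "P \<equiv> ring_of_type_algebra :: rat poly ring"
abbreviation "q \<equiv> [:- \<delta>, 0, 1:]"
abbreviation "K \<equiv> even_clifford \<delta>"

definition cls :: "rat poly \<Rightarrow> rat poly set" where
  "cls p = (PIdl\<^bsub>P\<^esub> q) +>\<^bsub>P\<^esub> p"

lemma even_clifford_eq: "K = P Quot (PIdl\<^bsub>P\<^esub> q)"
  by (simp add: even_clifford_def Let_def)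

lemma ideal_q: "ideal (PIdl\<^bsub>P\<^esub> q) P"
proof -
  interpret P: cring P by (rule cring_from_type_algebra)
  show ?thesis by (rule P.cgenideal_ideal) simp
qed

lemma cring_K: "cring K"
  unfolding even_clifford_eq by (rule ideal.quotient_is_cring[OF ideal_q cring_from_type_algebra])

lemma cls_hom: "cls \<in> ring_hom P K"
proof -
  have "cls = (+>\<^bsub>P\<^esub>) (PIdl\<^bsub>P\<^esub> q)" by (simp add: cls_def fun_eq_iff)
  then show ?thesis
    unfolding even_clifford_eq using ideal.rcos_ring_hom[OF ideal_q] by simp
qed

lemma cls_simps:
  "cls p \<otimes>\<^bsub>K\<^esub> cls r = cls (p * r)" "cls p \<oplus>\<^bsub>K\<^esub> cls r = cls (p + r)"
  "\<one>\<^bsub>K\<^esub> = cls 1" "cls p \<in> carrier K"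
  using ring_hom_mult[OF cls_hom, of p r] ring_hom_add[OF cls_hom, of p r]
    ring_hom_one[OF cls_hom] ring_hom_closed[OF cls_hom, of p] by simp_all

lemma cls_zero: "\<zero>\<^bsub>K\<^esub> = cls 0"
  using ring_hom_zero[OF cls_hom ring_from_type_algebra cring.axioms(1)[OF cring_K]] by simp

lemma cls_eq_zero_iff: "cls p = \<zero>\<^bsub>K\<^esub> \<longleftrightarrow> q dvd p"
proof -
  have "p \<in> PIdl\<^bsub>P\<^esub> q \<longleftrightarrow> q dvd p"
    by (auto simp: cgenideal_def dvd_def mult.commute)
  moreover have "\<zero>\<^bsub>K\<^esub> = PIdl\<^bsub>P\<^esub> q"
    by (simp add: even_clifford_eq FactRing_def)
  moreover have "cls p = PIdl\<^bsub>P\<^esub> q \<longleftrightarrow> p \<in> PIdl\<^bsub>P\<^esub> q"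
  proof -
    interpret ideal "PIdl\<^bsub>P\<^esub> q" P by (rule ideal_q)
    show ?thesis
      unfolding cls_def using a_rcos_const a_rcos_self[of p] by auto
  qed
  ultimately show ?thesis by simp
qed

lemma cls_eq_iff: "cls p = cls r \<longleftrightarrow> q dvd p - r"
proof
  interpret K: cring K by (rule cring_K)
  assume "cls p = cls r"
  then have "cls (p - r) \<oplus>\<^bsub>K\<^esub> cls r = \<zero>\<^bsub>K\<^esub> \<oplus>\<^bsub>K\<^esub> cls r"
    by (simp add: cls_simps cls_zero)
  then have "cls (p - r) = \<zero>\<^bsub>K\<^esub>"
    by (simp add: cls_simps(4))
  then show "q dvd p - r" by (simp add: cls_eq_zero_iff)
next
  interpret K: cring K by (rule cring_K)
  assume "q dvd p - r"
  then have "cls (p - r) = \<zero>\<^bsub>K\<^esub>" by (simp only: cls_eq_zero_iff)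
  then have "cls (p - r) \<oplus>\<^bsub>K\<^esub> cls r = \<zero>\<^bsub>K\<^esub> \<oplus>\<^bsub>K\<^esub> cls r" by (rule arg_cong)
  then show "cls p = cls r" by (simp add: cls_simps cls_zero)
qed

lemma linear_eq_zero_iff: "cls [:x, y:] = \<zero>\<^bsub>K\<^esub> \<longleftrightarrow> x = 0 \<and> y = 0"
proof
  assume "cls [:x, y:] = \<zero>\<^bsub>K\<^esub>"
  then have "q dvd [:x, y:]" by (simp add: cls_eq_zero_iff)
  moreover have "degree [:x, y:] < degree q" by simp
  ultimately have "[:x, y:] = 0" by (metis dvd_imp_degree_le not_le)
  then show "x = 0 \<and> y = 0" by simp
qed (simp add: cls_zero)

lemma linear_eq_iff: "cls [:x, y:] = cls [:x', y':] \<longleftrightarrow> x = x' \<and> y = y'"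
  using linear_eq_zero_iff[of "x - x'" "y - y'"] by (simp add: cls_eq_iff cls_eq_zero_iff)

lemma carrier_K: "carrier K = {cls [:x, y:] | x y. True}"
proof
  show "{cls [:x, y:] | x y. True} \<subseteq> carrier K" by (auto simp: cls_simps)
  show "carrier K \<subseteq> {cls [:x, y:] | x y. True}"
  proof
    fix c assume "c \<in> carrier K"
    then obtain p where p: "c = cls p"
      by (auto simp: even_clifford_eq FactRing_def A_RCOSETS_defs cls_def a_r_coset_def)
    have "degree (p mod q) < 2"
      using degree_mod_less'[of q p] by (cases "p mod q = 0") auto
    moreover obtain x s where xs: "p mod q = pCons x s" by (rule pCons_cases)
    ultimately have "degree s = 0" by (auto simp: degree_pCons_eq_if split: if_splits)
    then obtain y where "s = [:y:]" by (rule degree_eq_zeroE)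
    with xs have "p mod q = [:x, y:]" by simp
    moreover have "cls p = cls (p mod q)"
      unfolding cls_eq_iff by (rule dvd_minus_mod)
    ultimately show "c \<in> {cls [:x, y:] | x y. True}" using p by auto
  qed
qed

lemma linear_mult:
  "cls [:x, y:] \<otimes>\<^bsub>K\<^esub> cls [:x', y':] = cls [:x * x' + \<delta> * y * y', x * y' + y * x':]"
proof -
  have "[:x, y:] * [:x', y':] - [:x * x' + \<delta> * y * y', x * y' + y * x':] = q * [:y * y':]"
    by (simp add: algebra_simps)
  then show ?thesis
    unfolding cls_simps cls_eq_iff by (metis dvd_triv_left)
qed

text \<open>
  The inverse of \<open>x + y X\<close> is \<open>(x - y X) / (x\<^sup>2 - \<delta> y\<^sup>2)\<close>; the denominator is positive because
  \<open>\<delta>\<close> is negative.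
\<close>

lemma field_K: "field K"
proof -
  interpret K: cring K by (rule cring_K)
  show ?thesis
  proof (rule K.cring_fieldI2)
    show "\<zero>\<^bsub>K\<^esub> \<noteq> \<one>\<^bsub>K\<^esub>"
      using linear_eq_zero_iff[of 1 0] by (simp add: cls_simps one_pCons)
  next
    fix c assume "c \<in> carrier K" "c \<noteq> \<zero>\<^bsub>K\<^esub>"
    then obtain x y where c: "c = cls [:x, y:]" by (auto simp: carrier_K)
    with \<open>c \<noteq> \<zero>\<^bsub>K\<^esub>\<close> have "x \<noteq> 0 \<or> y \<noteq> 0" by (simp add: linear_eq_zero_iff)
    define n where "n = x\<^sup>2 + (- \<delta>) * y\<^sup>2"
    have "x\<^sup>2 \<ge> 0" "(- \<delta>) * y\<^sup>2 \<ge> 0" using neg by (simp_all add: mult_nonpos_nonneg)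
    moreover have "x\<^sup>2 > 0 \<or> (- \<delta>) * y\<^sup>2 > 0"
      using \<open>x \<noteq> 0 \<or> y \<noteq> 0\<close> neg by (auto simp: mult_less_0_iff)
    ultimately have "n > 0" unfolding n_def by linarith
    have "c \<otimes>\<^bsub>K\<^esub> cls [:x / n, - y / n:] =
        cls [:x * (x / n) + \<delta> * y * (- y / n), x * (- y / n) + y * (x / n):]"
      unfolding c by (rule linear_mult)
    also have "x * (x / n) + \<delta> * y * (- y / n) = (x\<^sup>2 + (- \<delta>) * y\<^sup>2) / n"
      by (simp add: add_divide_distrib diff_divide_distrib power2_eq_square)
    also have "\<dots> = 1" using \<open>n > 0\<close> by (simp add: n_def)
    also have "x * (- y / n) + y * (x / n) = 0" by simp
    finally have "c \<otimes>\<^bsub>K\<^esub> cls [:x / n, - y / n:] = \<one>\<^bsub>K\<^esub>"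
      by (simp add: cls_simps one_pCons)
    then show "\<exists>d\<in>carrier K. c \<otimes>\<^bsub>K\<^esub> d = \<one>\<^bsub>K\<^esub>"
      using cls_simps(4) by blast
  qed
qed

lemma dimension_K: "ring.dimension K 2 (range (\<lambda>r. cls [:r:])) (carrier K)"
proof -
  interpret K: cring K by (rule cring_K)
  let ?F = "range (\<lambda>r. cls [:r:])"
  have ext: "K.line_extension ?F v E = {cls [:r:] \<otimes>\<^bsub>K\<^esub> v \<oplus>\<^bsub>K\<^esub> e | r e. e \<in> E}" for v E
    by (auto simp: K.line_extension_def set_add_def set_mult_def r_coset_def)
  have "cls [:1:] \<notin> {\<zero>\<^bsub>K\<^esub>}"
    using linear_eq_zero_iff[of 1 0] by simp
  from K.Suc_dim[OF cls_simps(4) this K.zero_dim, of ?F]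
  have "K.dimension (Suc 0) ?F (K.line_extension ?F (cls [:1:]) {\<zero>\<^bsub>K\<^esub>})" .
  moreover have "K.line_extension ?F (cls [:1:]) {\<zero>\<^bsub>K\<^esub>} = ?F"
    by (auto simp: ext cls_simps cls_zero)
  ultimately have "K.dimension (Suc 0) ?F ?F" by (simp only:)
  moreover have "cls [:0, 1:] \<notin> ?F"
    using linear_eq_iff[of 0 1 _ 0] by auto
  ultimately have "K.dimension (Suc (Suc 0)) ?F (K.line_extension ?F (cls [:0, 1:]) ?F)"
    by (intro K.Suc_dim cls_simps(4))
  moreover have "K.line_extension ?F (cls [:0, 1:]) ?F = carrier K"
  proof
    show "K.line_extension ?F (cls [:0, 1:]) ?F \<subseteq> carrier K"
      by (auto simp: ext cls_simps)
    have "cls [:x, y:] = cls [:y:] \<otimes>\<^bsub>K\<^esub> cls [:0, 1:] \<oplus>\<^bsub>K\<^esub> cls [:x:]" for x y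
      by (simp add: cls_simps)
    then show "carrier K \<subseteq> K.line_extension ?F (cls [:0, 1:]) ?F"
      unfolding ext carrier_K by blast
  qed
  ultimately show ?thesis by (simp add: numeral_2_eq_2)
qed

text \<open>
  An embedding into \<open>\<real>\<close> would send \<open>X\<close> to a real number whose square is negative.
\<close>

lemma no_real_embedding: "ring_hom K (ring_of_type_algebra :: real ring) = {}"
proof (rule ccontr)
  let ?R = "ring_of_type_algebra :: real ring"
  assume "ring_hom K ?R \<noteq> {}"
  then obtain h where h: "h \<in> ring_hom K ?R" by blast
  define g where "g = h \<circ> cls"
  have "g \<in> ring_hom P ?R"
    unfolding g_def using cls_hom h by (rule ring_hom_trans)
  then have add: "g (p + r) = g p + g r" and mult: "g (p * r) = g p * g r" and one: "g 1 = 1" for p r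
    using ring_hom_add[of g P ?R p r] ring_hom_mult[of g P ?R p r] ring_hom_one[of g P ?R] by simp_all
  have "g [:- \<delta>:] > 0"
    using neg add mult one
    by (intro rat_ring_hom_real_pos[of "\<lambda>r. g [:r:]"])
      (simp_all add: add[symmetric] mult[symmetric] one_pCons[symmetric] mult.commute)
  moreover have "g ([:0, 1:] * [:0, 1:] + [:- \<delta>:]) = g 0"
  proof -
    have "[:0, 1:] * [:0, 1:] + [:- \<delta>:] = q" by simp
    moreover have "cls q = cls 0" unfolding cls_eq_iff by simp
    ultimately show ?thesis by (simp only: g_def o_apply)
  qed
  moreover have "g 0 = 0" using add[of 0 0] by simp
  ultimately have "g [:0, 1:] * g [:0, 1:] < 0"
    unfolding add mult by linarith
  then show False by (simp add: mult_less_0_iff)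
qed

lemma imaginary_quadratic: "imaginary_quadratic_extension K"
proof -
  have "(\<lambda>r. cls [:r:]) \<in> ring_hom (ring_of_type_algebra :: rat ring) K"
    by (rule ring_hom_memI) (simp_all add: cls_simps one_pCons mult.commute)
  with field_K dimension_K no_real_embedding show ?thesis
    unfolding imaginary_quadratic_extension_def by blast
qed

end


section \<open>The even Clifford algebra of a definite quaternion algebra\<close>

theorem proposition4p3p3:
  fixes scale :: "rat \<Rightarrow> 'b::ring_1 \<Rightarrow> 'b"
    and \<sigma> :: "'b \<Rightarrow> 'b"
    and \<delta> :: rat
  assumes "quaternion_algebra scale"
    and "ramified_at_infinity TYPE('d::real_div_algebra) scale"
    and "first_kind_involution scale \<sigma>"
    and "orthogonal_involution TYPE('l::field_char_0) scale \<sigma>"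
    and "\<delta> \<in> discriminant scale \<sigma>"
  shows "imaginary_quadratic_extension (even_clifford \<delta>)"
proof -
  have "\<delta> < 0" using assms by (rule discriminant_neg)
  then interpret negative_quadratic \<delta> by unfold_locales
  show ?thesis by (rule imaginary_quadratic)
qed

end
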